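(* For all positive integers $n$ and $e$ with $2e\le n$, there exist optima $A^E$ and $A^O$ of the $(n,2e)$ and $(n-1,2e-1)$ Delsarte linear programs, respectively, whose Krawtchouk decompositions agree on indices $0$ through $n-1$, inclusive.
   Context: $[a]=\{1,\dots,a\}$ (empty if $a\le 0$). $\binom{a}{b}=0$ unless $0\le b\le a$. For a block length $m$ and $0\le i,j\le m$, the Krawtchouk polynomial is $K_j(i;m)=\sum_{k=0}^j(-1)^k\binom{i}{k}\binom{m-i}{j-k}$. For integers $1\le d\le m$, the $(m,d)$ Delsarte linear program, in real variables $A=(A_0,\dots,A_m)$, is: maximize $\sum_{i=0}^m A_i$ subject to $\sum_{i=0}^m A_iK_j(i;m)\ge 0$ for all $j\in[m]$; $A_i=0$ for all $i\in[d-1]$; $A_0=1$; $A_i\ge 0$ for all $i\in[m]$. An optimum is a feasible point achieving the optimal objective value. The Krawtchouk decomposition of a feasible point $A=(A_0,\dots,A_m)$ (block length $m$) is the vector $b=(b_0,\dots,b_m)$ with $b_j=\frac{1}{\binom{m}{j}}\sum_{i=0}^m A_iK_j(i;m)$; equivalently $A_i=\binom{m}{i}\left(\sum_{j=0}^m b_jK_j(i;m)\right)/2^m$ for all $0\le i\le m$. The Krawtchouk decomposition of $A^E$ uses block length $m=n$, and that of $A^O$ uses $m=n-1$. *)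

theory Defs
  imports Complex_Main
begin

text \<open>
  \<open>krawtchouk m j i\<close> is \<open>K_j(i; m)\<close>, meant for \<open>i, j \<le> m\<close>; in that range the
  subtractions on \<^typ>\<open>nat\<close> do not truncate.
\<close>

definition krawtchouk :: "nat \<Rightarrow> nat \<Rightarrow> nat \<Rightarrow> real" where
  "krawtchouk m j i =
     (\<Sum>k=0..j. (-1) ^ k * real (i choose k) * real ((m - i) choose (j - k)))"

text \<open>
  A point \<open>(A_0, \<dots>, A_m)\<close> is a function \<^typ>\<open>nat \<Rightarrow> real\<close> of which only the values at
  \<open>0, \<dots>, m\<close> matter: nothing below reads or constrains the other values.
\<close>

definition delsarte_feasible :: "nat \<Rightarrow> nat \<Rightarrow> (nat \<Rightarrow> real) \<Rightarrow> bool" where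
  "delsarte_feasible m d A \<longleftrightarrow>
     (\<forall>j\<in>{1..m}. (\<Sum>i=0..m. A i * krawtchouk m j i) \<ge> 0) \<and>
     (\<forall>i\<in>{1..d - 1}. A i = 0) \<and>
     A 0 = 1 \<and>
     (\<forall>i\<in>{1..m}. A i \<ge> 0)"

definition delsarte_objective :: "nat \<Rightarrow> (nat \<Rightarrow> real) \<Rightarrow> real" where
  "delsarte_objective m A = (\<Sum>i=0..m. A i)"

definition delsarte_optimum :: "nat \<Rightarrow> nat \<Rightarrow> (nat \<Rightarrow> real) \<Rightarrow> bool" where
  "delsarte_optimum m d A \<longleftrightarrow>
     delsarte_feasible m d A \<and>
     (\<forall>B. delsarte_feasible m d B \<longrightarrow> delsarte_objective m B \<le> delsarte_objective m A)"

definition krawtchouk_decomposition :: "nat \<Rightarrow> (nat \<Rightarrow> real) \<Rightarrow> nat \<Rightarrow> real" where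
  "krawtchouk_decomposition m A j =
     1 / real (m choose j) * (\<Sum>i=0..m. A i * krawtchouk m j i)"

end

theory Submission
  imports Defs "HOL-Analysis.Function_Topology"
begin

text \<open>
  Two maps between the \<open>(n, 2e)\<close> and \<open>(n - 1, 2e - 1)\<close> programs carry the proof; both keep
  the objective value and send feasible points to feasible points. Let \<open>n = m + 1\<close>.

  Puncturing sends a point \<open>A\<close> of length \<open>m + 1\<close> to the point of length \<open>m\<close> with entries
  \<open>((m + 1 - i) A\<^sub>i + (i + 1) A\<^sub>i\<^sub>+\<^sub>1) / (m + 1)\<close>. If \<open>A\<close> is read as a function on the cube
  that depends only on the weight and has total mass \<open>A\<^sub>i\<close> in weight \<open>i\<close>, this is its marginal
  on the first \<open>m\<close> coordinates. The Fourier coefficients of a marginal are the coefficients of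
  the original function at the subsets of the remaining coordinates, so puncturing preserves the
  Krawtchouk decomposition at all indices up to \<open>m\<close>.

  Extending goes back: as when a parity bit is appended to a code, the mass in an odd weight
  \<open>i\<close> moves to weight \<open>i + 1\<close>. If \<open>T\<close> denotes the transform \<open>j \<mapsto> \<Sum>\<^sub>i A\<^sub>i K\<^sub>j(i; m)\<close> of a
  point of length \<open>m\<close>, the Pascal-type recurrences and the reflection
  \<open>K\<^sub>m\<^sub>-\<^sub>j(i; m) = (-1)\<^sup>i K\<^sub>j(i; m)\<close> show that the extended point has transform
  \<open>T\<^sub>j + T\<^sub>m\<^sub>+\<^sub>1\<^sub>-\<^sub>j\<close>, which is nonnegative.

  The \<open>(n, 2e)\<close> program has an optimum, because its feasible region is compact up to irrelevant
  entries: the transforms of a feasible point sum to \<open>2\<^sup>n\<close>, which bounds the objective. The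
  punctured optimum is optimal for the \<open>(n - 1, 2e - 1)\<close> program, since a better point there
  would extend to a better point of the \<open>(n, 2e)\<close> program.
\<close>

section \<open>Krawtchouk polynomials\<close>

lemma krawtchouk_0 [simp]: "krawtchouk m 0 i = 1"
  by (simp add: krawtchouk_def)

lemma krawtchouk_at_0: "krawtchouk m j 0 = real (m choose j)"
proof -
  have "krawtchouk m j 0 = (\<Sum>k=0..j. if k = 0 then real (m choose j) else 0)"
    unfolding krawtchouk_def by (rule sum.cong) auto
  then show ?thesis by simp
qed

lemma krawtchouk_eq_0_of_gt:
  assumes "i \<le> m" and "m < j"
  shows "krawtchouk m j i = 0"
  unfolding krawtchouk_def
proof (intro sum.neutral ballI)
  fix k assume "k \<in> {0..j}"
  have "i < k \<or> m - i < j - k" using assms by auto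
  then show "(-1) ^ k * real (i choose k) * real ((m - i) choose (j - k)) = 0"
    by (auto simp: binomial_eq_0)
qed

text \<open>
  In terms of the generating function \<open>(1 - x)\<^sup>i (1 + x)\<^sup>m\<^sup>-\<^sup>i\<close> of \<open>j \<mapsto> K\<^sub>j(i; m)\<close>, this and
  the next lemma multiply by \<open>1 + x\<close> and by \<open>1 - x\<close>.
\<close>

lemma krawtchouk_Suc_same_weight:
  assumes "i \<le> m"
  shows "krawtchouk (Suc m) (Suc j) i = krawtchouk m (Suc j) i + krawtchouk m j i"
proof -
  have "(\<Sum>k=0..j. (-1) ^ k * real (i choose k) * real ((Suc m - i) choose (Suc j - k)))
     = (\<Sum>k=0..j. (-1) ^ k * real (i choose k) * real ((m - i) choose (Suc j - k))
          + (-1) ^ k * real (i choose k) * real ((m - i) choose (j - k)))"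
  proof (rule sum.cong)
    fix k assume "k \<in> {0..j}"
    with assms have "Suc m - i = Suc (m - i)" "Suc j - k = Suc (j - k)" by auto
    then show "(-1) ^ k * real (i choose k) * real ((Suc m - i) choose (Suc j - k))
      = (-1) ^ k * real (i choose k) * real ((m - i) choose (Suc j - k))
          + (-1) ^ k * real (i choose k) * real ((m - i) choose (j - k))"
      by (simp add: algebra_simps)
  qed simp
  then show ?thesis
    by (simp add: krawtchouk_def sum.distrib)
qed

lemma krawtchouk_Suc_Suc_weight:
  "krawtchouk (Suc m) (Suc j) (Suc i) = krawtchouk m (Suc j) i - krawtchouk m j i"
proof -
  let ?c = "\<lambda>k. real ((m - i) choose (Suc j - k))"
  have "krawtchouk (Suc m) (Suc j) (Suc i)
      = ?c 0 + (\<Sum>k=0..j. (-1) ^ Suc k * real (Suc i choose Suc k) * ?c (Suc k))"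
    unfolding krawtchouk_def by (subst sum.atLeast0_atMost_Suc_shift) simp
  also have "\<dots> = (?c 0 + (\<Sum>k=0..j. (-1) ^ Suc k * real (i choose Suc k) * ?c (Suc k)))
      + (\<Sum>k=0..j. (-1) ^ Suc k * real (i choose k) * ?c (Suc k))"
    by (simp add: sum.distrib[symmetric] algebra_simps)
  also have "?c 0 + (\<Sum>k=0..j. (-1) ^ Suc k * real (i choose Suc k) * ?c (Suc k))
      = krawtchouk m (Suc j) i"
    unfolding krawtchouk_def by (subst sum.atLeast0_atMost_Suc_shift) simp
  also have "(\<Sum>k=0..j. (-1) ^ Suc k * real (i choose k) * ?c (Suc k)) = - krawtchouk m j i"
    by (simp add: krawtchouk_def sum_negf)
  finally show ?thesis by simp
qed

text \<open>
  Substituting \<open>k \<mapsto> i - k\<close> in the defining sum replaces both binomial coefficients by their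
  mirror images.
\<close>

lemma krawtchouk_reflect:
  assumes "i \<le> m" and "j \<le> m"
  shows "krawtchouk m (m - j) i = (-1) ^ i * krawtchouk m j i"
proof -
  let ?t = "\<lambda>j k. (-1) ^ k * real (i choose k) * real ((m - i) choose (j - k))"
  let ?S = "\<lambda>j. {k. k \<le> i \<and> k \<le> j \<and> j - k \<le> m - i}"
  have restrict: "krawtchouk m j' i = sum (?t j') (?S j')" for j'
    unfolding krawtchouk_def
  proof (rule sum.mono_neutral_right)
    show "\<forall>k\<in>{0..j'} - ?S j'. ?t j' k = 0"
    proof
      fix k assume "k \<in> {0..j'} - ?S j'"
      then have "i < k \<or> m - i < j' - k" by auto
      then show "?t j' k = 0" by (auto simp: binomial_eq_0)
    qed
  qed auto
  have "sum (?t (m - j)) (?S (m - j)) = (\<Sum>k\<in>?S j. (-1) ^ i * ?t j k)"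
  proof (rule sum.reindex_bij_witness[of _ "\<lambda>k. i - k" "\<lambda>k. i - k"])
    fix k assume k: "k \<in> ?S (m - j)"
    show "i - (i - k) = k" "i - k \<in> ?S j" using k assms by auto
    have "(m - i) choose (m - j - k) = (m - i) choose (m - i - (m - j - k))"
      using k by (subst binomial_symmetric) auto
    also have "m - i - (m - j - k) = j - (i - k)" using k assms by auto
    finally have b: "(m - i) choose (m - j - k) = (m - i) choose (j - (i - k))" .
    have c: "i choose (i - k) = i choose k" using k by (simp add: binomial_symmetric[symmetric])
    have "even (i + (i - k)) = even k" using k by auto
    then have "(-1 :: real) ^ i * (-1) ^ (i - k) = (-1) ^ k"
      by (metis power_add minus_one_power_iff)
    then have s: "(-1) ^ i * ((-1) ^ (i - k) * x) = (-1) ^ k * x" for x :: real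
      by (metis mult.assoc)
    show "(-1) ^ i * ?t j (i - k) = ?t (m - j) k"
      unfolding mult.assoc s b c ..
  next
    fix k assume k: "k \<in> ?S j"
    show "i - (i - k) = k" "i - k \<in> ?S (m - j)" using k assms by auto
  qed
  then show ?thesis by (simp add: restrict sum_distrib_left)
qed

text \<open>
  This is the coefficient form of evaluating \<open>(1 - x)\<^sup>i (1 + x)\<^sup>m\<^sup>-\<^sup>i\<close> at \<open>1\<close>; for \<open>i > 0\<close>
  the recurrence makes the sum telescope.
\<close>

lemma sum_krawtchouk:
  assumes "i \<le> m"
  shows "(\<Sum>j=0..m. krawtchouk m j i) = (if i = 0 then 2 ^ m else 0)"
proof (cases i)
  case 0
  have "(\<Sum>j=0..m. real (m choose j)) = 2 ^ m"
    using choose_row_sum[of m] by (metis atLeast0AtMost of_nat_numeral of_nat_power of_nat_sum)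
  with 0 show ?thesis by (simp add: krawtchouk_at_0)
next
  case (Suc h)
  with assms obtain l where l: "m = Suc l" by (cases m) auto
  have partial: "(\<Sum>j=0..r. krawtchouk (Suc l) j (Suc h)) = krawtchouk l r h" for r
    by (induction r) (auto simp: krawtchouk_Suc_Suc_weight)
  have "(\<Sum>j=0..m. krawtchouk m j i) = krawtchouk l m h"
    unfolding Suc l by (rule partial)
  then show ?thesis using assms Suc l by (simp add: krawtchouk_eq_0_of_gt)
qed

lemma of_nat_absorb_binomial:
  "real a * real ((a - 1) choose b) = (real a - real b) * real (a choose b)"
proof (cases a)
  case 0
  then show ?thesis by (cases b) auto
next
  case (Suc c)
  show ?thesis
  proof (cases "b \<le> Suc c")
    case True
    have "(Suc c - b) * (Suc c choose b) = Suc c * (c choose b)"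
      using binomial_absorb_comp[of "Suc c" b] by simp
    then have "real (Suc c - b) * real (Suc c choose b) = real (Suc c) * real (c choose b)"
      by (metis of_nat_mult)
    with True Suc show ?thesis by (simp add: of_nat_diff)
  next
    case False
    with Suc show ?thesis by (simp add: binomial_eq_0)
  qed
qed

text \<open>
  For a word of weight \<open>i\<close>, average over the coordinate that is deleted: there are \<open>m + 1 - i\<close>
  zeros and \<open>i\<close> ones. A set of \<open>j\<close> coordinates survives \<open>m + 1 - j\<close> of the deletions. The
  identity holds term by term in the defining sums.
\<close>

lemma krawtchouk_delete_coordinate:
  assumes "i \<le> Suc m"
  shows "real (Suc m - i) * krawtchouk m j i + real i * krawtchouk m j (i - 1)
       = (real (Suc m) - real j) * krawtchouk (Suc m) j i"
proof -
  have "real (Suc m - i) * ((-1) ^ k * real (i choose k) * real ((m - i) choose (j - k)))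
      + real i * ((-1) ^ k * real ((i - 1) choose k) * real ((m - (i - 1)) choose (j - k)))
      = (real (Suc m) - real j)
        * ((-1) ^ k * real (i choose k) * real ((Suc m - i) choose (j - k)))"
    (is "?L = ?R") if "k \<in> {0..j}" for k
  proof -
    define s :: real where "s = (-1) ^ k"
    define a where "a = Suc m - i"
    have zeros: "real a * real ((m - i) choose (j - k))
        = (real a - real (j - k)) * real (a choose (j - k))"
      using of_nat_absorb_binomial[of a "j - k"] by (simp add: a_def)
    have ones: "real i * real ((i - 1) choose k) * real ((m - (i - 1)) choose (j - k))
        = (real i - real k) * real (i choose k) * real (a choose (j - k))"
    proof (cases i)
      case 0
      then show ?thesis by (cases k) auto
    next
      case (Suc h)
      then have "m - (i - 1) = a" by (simp add: a_def)
      then show ?thesis by (simp only: of_nat_absorb_binomial)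
    qed
    have "?L = s * (real (i choose k) * (real a * real ((m - i) choose (j - k)))
        + real i * real ((i - 1) choose k) * real ((m - (i - 1)) choose (j - k)))"
      by (simp add: s_def a_def algebra_simps)
    also have "\<dots> = s * (real (i choose k) * real (a choose (j - k)))
        * (real a - real (j - k) + (real i - real k))"
      unfolding zeros ones by (simp add: algebra_simps)
    also have "real a - real (j - k) + (real i - real k) = real (Suc m) - real j"
      using that assms by (simp add: a_def of_nat_diff)
    finally show ?thesis by (simp add: s_def a_def algebra_simps)
  qed
  then show ?thesis
    unfolding krawtchouk_def sum_distrib_left sum.distrib[symmetric] by (rule sum.cong[OF refl])
qed

section \<open>The transform of a point and its positivity\<close>

definition krawtchouk_transform :: "nat \<Rightarrow> (nat \<Rightarrow> real) \<Rightarrow> nat \<Rightarrow> real" where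
  "krawtchouk_transform m A j = (\<Sum>i=0..m. A i * krawtchouk m j i)"

lemma krawtchouk_transform_0: "krawtchouk_transform m A 0 = delsarte_objective m A"
  by (simp add: krawtchouk_transform_def delsarte_objective_def)

lemma delsarte_feasible_nonneg:
  assumes "delsarte_feasible m d A" and "i \<le> m"
  shows "A i \<ge> 0"
  using assms by (cases i) (auto simp: delsarte_feasible_def)

lemma krawtchouk_transform_nonneg:
  assumes "delsarte_feasible m d A"
  shows "krawtchouk_transform m A j \<ge> 0"
proof -
  consider "j = 0" | "j \<in> {1..m}" | "m < j" by force
  then show ?thesis
  proof cases
    case 1
    then show ?thesis
      using assms delsarte_feasible_nonneg
      by (auto simp: krawtchouk_transform_def intro!: sum_nonneg)
  next
    case 2
    then show ?thesis
      using assms unfolding delsarte_feasible_def krawtchouk_transform_def by blast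
  next
    case 3
    then show ?thesis by (simp add: krawtchouk_transform_def krawtchouk_eq_0_of_gt)
  qed
qed

lemma sum_krawtchouk_transform:
  "(\<Sum>j=0..m. krawtchouk_transform m A j) = 2 ^ m * A 0"
proof -
  have "(\<Sum>j=0..m. krawtchouk_transform m A j)
      = (\<Sum>i=0..m. A i * (\<Sum>j=0..m. krawtchouk m j i))"
    unfolding krawtchouk_transform_def sum_distrib_left by (rule sum.swap)
  also have "\<dots> = (\<Sum>i=0..m. if i = 0 then 2 ^ m * A 0 else 0)"
    by (rule sum.cong) (auto simp: sum_krawtchouk)
  finally show ?thesis by simp
qed

section \<open>Existence of optima\<close>

text \<open>
  The objective is the transform at \<open>0\<close>, and the nonnegative transforms sum to \<open>2\<^sup>m\<close>.
\<close>

lemma delsarte_objective_le: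
  assumes "delsarte_feasible m d A"
  shows "delsarte_objective m A \<le> 2 ^ m"
proof -
  have "krawtchouk_transform m A 0 \<le> (\<Sum>j=0..m. krawtchouk_transform m A j)"
    by (rule member_le_sum) (use krawtchouk_transform_nonneg[OF assms] in auto)
  also have "\<dots> = 2 ^ m"
    using assms by (simp add: sum_krawtchouk_transform delsarte_feasible_def)
  finally show ?thesis by (simp add: krawtchouk_transform_0)
qed

lemma delsarte_feasible_unit: "delsarte_feasible m d (\<lambda>i. if i = 0 then 1 else 0)"
  by (auto simp: delsarte_feasible_def if_distrib[of "\<lambda>x. x * _"] krawtchouk_at_0 cong: if_cong)

text \<open>
  Setting the entries beyond \<open>m\<close> to zero changes neither feasibility nor the objective, so it
  suffices to maximize over a closed subset of a product of compact intervals.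
\<close>

lemma delsarte_optimum_exists: "\<exists>A. delsarte_optimum m d A"
proof -
  define box :: "(nat \<Rightarrow> real) set" where
    "box = (\<Pi>\<^sub>E i\<in>UNIV. if i \<le> m then {0..2 ^ m} else {0})"
  define F where "F = {A. delsarte_feasible m d A}"
  have coord: "continuous_on UNIV (\<lambda>A :: nat \<Rightarrow> real. A i)" for i
    by (rule continuous_on_product_coordinates)
  have F_eq: "F = (\<Inter>j\<in>{1..m}. {A. (\<Sum>i=0..m. A i * krawtchouk m j i) \<ge> 0})
      \<inter> (\<Inter>i\<in>{1..d - 1}. {A. A i = 0}) \<inter> {A. A 0 = 1} \<inter> (\<Inter>i\<in>{1..m}. {A. A i \<ge> 0})"
    by (auto simp: F_def delsarte_feasible_def)
  have "closed F"
    unfolding F_eq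
    by (intro closed_Int closed_INT ballI closed_Collect_le closed_Collect_eq
          continuous_intros coord)
  moreover have "compact box"
    unfolding compactin_euclidean_iff[symmetric] euclidean_product_topology[symmetric] box_def
    by (subst compactin_PiE) (auto simp: compactin_euclidean_iff)
  ultimately have "compact (box \<inter> F)" by (rule compact_Int_closed[rotated])
  moreover have "(\<lambda>i. if i = 0 then 1 else 0) \<in> box \<inter> F"
    by (auto simp: F_def box_def delsarte_feasible_unit)
  then have "box \<inter> F \<noteq> {}" by blast
  moreover have "continuous_on (box \<inter> F) (delsarte_objective m)"
    unfolding delsarte_objective_def
    by (intro continuous_on_sum continuous_on_subset[OF coord]) auto
  ultimately obtain A where A: "A \<in> box \<inter> F"
    and max: "\<And>B. B \<in> box \<inter> F \<Longrightarrow> delsarte_objective m B \<le> delsarte_objective m A"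
    using continuous_attains_sup[of "box \<inter> F" "delsarte_objective m"] by blast
  have "delsarte_objective m B \<le> delsarte_objective m A" if B: "delsarte_feasible m d B" for B
  proof -
    let ?B = "\<lambda>i. if i \<le> m then B i else 0"
    have "B i \<le> 2 ^ m" if "i \<le> m" for i
    proof -
      have "B i \<le> delsarte_objective m B"
        unfolding delsarte_objective_def
        by (rule member_le_sum) (use that delsarte_feasible_nonneg[OF B] in auto)
      with delsarte_objective_le[OF B] show ?thesis by linarith
    qed
    then have "?B \<in> box" using delsarte_feasible_nonneg[OF B] by (auto simp: box_def)
    moreover have "delsarte_feasible m d ?B"
      using B by (auto simp: delsarte_feasible_def)
    ultimately have "delsarte_objective m ?B \<le> delsarte_objective m A"
      by (intro max) (simp add: F_def)
    then show ?thesis by (simp add: delsarte_objective_def)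
  qed
  with A show ?thesis by (auto simp: delsarte_optimum_def F_def)
qed

section \<open>Puncturing\<close>

definition puncture :: "nat \<Rightarrow> (nat \<Rightarrow> real) \<Rightarrow> nat \<Rightarrow> real" where
  "puncture m A i = (real (Suc m - i) * A i + real (Suc i) * A (Suc i)) / real (Suc m)"

lemma krawtchouk_transform_puncture:
  "krawtchouk_transform m (puncture m A) j
     = (real (Suc m) - real j) / real (Suc m) * krawtchouk_transform (Suc m) A j"
proof -
  let ?n = "real (Suc m)"
  have "krawtchouk_transform m (puncture m A) j * ?n
      = (\<Sum>i=0..m. A i * (real (Suc m - i) * krawtchouk m j i))
        + (\<Sum>i=0..m. A (Suc i) * (real (Suc i) * krawtchouk m j (Suc i - 1)))"
    unfolding krawtchouk_transform_def sum_distrib_right sum.distrib[symmetric]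
    by (rule sum.cong) (auto simp: puncture_def field_simps)
  also have "(\<Sum>i=0..m. A i * (real (Suc m - i) * krawtchouk m j i))
      = (\<Sum>i=0..Suc m. A i * (real (Suc m - i) * krawtchouk m j i))"
    by simp
  also have "(\<Sum>i=0..m. A (Suc i) * (real (Suc i) * krawtchouk m j (Suc i - 1)))
      = (\<Sum>i=0..Suc m. A i * (real i * krawtchouk m j (i - 1)))"
    by (subst sum.atLeast0_atMost_Suc_shift) simp
  also have "(\<Sum>i=0..Suc m. A i * (real (Suc m - i) * krawtchouk m j i))
        + (\<Sum>i=0..Suc m. A i * (real i * krawtchouk m j (i - 1)))
      = (\<Sum>i=0..Suc m. A i * ((?n - real j) * krawtchouk (Suc m) j i))"
    unfolding sum.distrib[symmetric]
  proof (rule sum.cong[OF refl])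
    fix i assume "i \<in> {0..Suc m}"
    then have "i \<le> Suc m" by simp
    then show "A i * (real (Suc m - i) * krawtchouk m j i) + A i * (real i * krawtchouk m j (i - 1))
        = A i * ((?n - real j) * krawtchouk (Suc m) j i)"
      unfolding krawtchouk_delete_coordinate[symmetric, OF \<open>i \<le> Suc m\<close>]
      by (simp add: distrib_left)
  qed
  also have "\<dots> = (?n - real j) * krawtchouk_transform (Suc m) A j"
    unfolding krawtchouk_transform_def sum_distrib_left by (rule sum.cong) (auto simp: algebra_simps)
  finally show ?thesis by (simp add: field_simps del: of_nat_Suc)
qed

text \<open>
  The factor by which puncturing scales the transform is the ratio of \<open>m choose j\<close> and
  \<open>(m + 1) choose j\<close>.
\<close>

lemma krawtchouk_decomposition_puncture:
  assumes "j \<le> m"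
  shows "krawtchouk_decomposition m (puncture m A) j = krawtchouk_decomposition (Suc m) A j"
proof -
  have dec: "krawtchouk_decomposition l B j
      = krawtchouk_transform l B j / real (l choose j)" for l B
    by (simp add: krawtchouk_decomposition_def krawtchouk_transform_def)
  have "real (Suc m) * real (m choose j) = (real (Suc m) - real j) * real (Suc m choose j)"
    using of_nat_absorb_binomial[of "Suc m" j] by simp
  moreover have "real (m choose j) > 0" "real (Suc m choose j) > 0" "real (Suc m) - real j > 0"
    using assms by (auto simp: zero_less_binomial_iff simp del: binomial_Suc_Suc)
  ultimately have "(real (Suc m) - real j) / real (Suc m) / real (m choose j)
      = 1 / real (Suc m choose j)"
    by (simp add: field_simps del: of_nat_Suc)
  then show ?thesis
    by (simp add: dec krawtchouk_transform_puncture mult.commute del: of_nat_Suc)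
       (metis (no_types, lifting) divide_divide_eq_left mult.right_neutral times_divide_eq_right)
qed

lemma delsarte_objective_puncture:
  "delsarte_objective m (puncture m A) = delsarte_objective (Suc m) A"
  unfolding krawtchouk_transform_0[symmetric] by (simp add: krawtchouk_transform_puncture)

lemma delsarte_feasible_puncture:
  assumes A: "delsarte_feasible (Suc m) (Suc d) A" and "d \<ge> 1"
  shows "delsarte_feasible m d (puncture m A)"
  unfolding delsarte_feasible_def krawtchouk_transform_def[symmetric]
proof (intro conjI ballI)
  fix j assume "j \<in> {1..m}"
  then show "0 \<le> krawtchouk_transform m (puncture m A) j"
    unfolding krawtchouk_transform_puncture
    by (intro mult_nonneg_nonneg krawtchouk_transform_nonneg[OF A]) auto
next
  fix i assume "i \<in> {1..d - 1}"
  then show "puncture m A i = 0" using A by (auto simp: delsarte_feasible_def puncture_def)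
next
  show "puncture m A 0 = 1" using A assms(2) by (auto simp: delsarte_feasible_def puncture_def)
next
  fix i assume "i \<in> {1..m}"
  then show "0 \<le> puncture m A i"
    using delsarte_feasible_nonneg[OF A, of i] delsarte_feasible_nonneg[OF A, of "Suc i"]
    by (auto simp: puncture_def)
qed

section \<open>Extending by a parity coordinate\<close>

text \<open>
  The guards make only the entries of \<open>A\<close> at \<open>0, \<dots>, m\<close> enter: at the top weight
  \<open>m + 1\<close> and at weight \<open>0\<close> there is only one contribution.
\<close>

definition parity_extend :: "nat \<Rightarrow> (nat \<Rightarrow> real) \<Rightarrow> nat \<Rightarrow> real" where
  "parity_extend m A i = (if even i
     then (if i \<le> m then A i else 0) + (if i = 0 then 0 else A (i - 1)) else 0)"

lemma sum_parity_extend: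
  "(\<Sum>i=0..Suc m. parity_extend m A i * g i)
     = (\<Sum>i=0..m. A i * g (if even i then i else Suc i))"
proof -
  let ?stay = "\<lambda>i. if even i \<and> i \<le> m then A i * g i else 0"
  let ?move = "\<lambda>i. if even i \<and> i \<noteq> 0 then A (i - 1) * g i else 0"
  have "(\<Sum>i=0..Suc m. parity_extend m A i * g i) = sum ?stay {0..Suc m} + sum ?move {0..Suc m}"
    unfolding sum.distrib[symmetric]
    by (rule sum.cong) (auto simp: parity_extend_def algebra_simps)
  also have "sum ?stay {0..Suc m} = sum ?stay {0..m}" by simp
  also have "sum ?move {0..Suc m} = (\<Sum>i=0..m. ?move (Suc i))"
    by (subst sum.atLeast0_atMost_Suc_shift) simp
  also have "sum ?stay {0..m} + (\<Sum>i=0..m. ?move (Suc i))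
      = (\<Sum>i=0..m. A i * g (if even i then i else Suc i))"
    unfolding sum.distrib[symmetric] by (rule sum.cong) auto
  finally show ?thesis .
qed

lemma delsarte_objective_parity_extend:
  "delsarte_objective (Suc m) (parity_extend m A) = delsarte_objective m A"
  using sum_parity_extend[of m A "\<lambda>_. 1"] by (simp add: delsarte_objective_def)

text \<open>
  The parity-dependent choice between the two recurrences produces the sign \<open>(-1)\<^sup>i\<close>, which the
  reflection absorbs.
\<close>

lemma krawtchouk_transform_parity_extend:
  assumes "j \<le> m"
  shows "krawtchouk_transform (Suc m) (parity_extend m A) (Suc j)
       = krawtchouk_transform m A (Suc j) + krawtchouk_transform m A (m - j)"
proof -
  have "krawtchouk_transform (Suc m) (parity_extend m A) (Suc j)
      = (\<Sum>i=0..m. A i * krawtchouk (Suc m) (Suc j) (if even i then i else Suc i))"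
    unfolding krawtchouk_transform_def by (rule sum_parity_extend)
  also have "\<dots> = (\<Sum>i=0..m. A i * krawtchouk m (Suc j) i + A i * krawtchouk m (m - j) i)"
    using assms
    by (intro sum.cong refl)
       (auto simp: krawtchouk_Suc_same_weight krawtchouk_Suc_Suc_weight krawtchouk_reflect
          minus_one_power_iff algebra_simps)
  finally show ?thesis by (simp add: krawtchouk_transform_def sum.distrib)
qed

text \<open>
  The distance bound must be odd: an entry at weight \<open>d\<close> itself may be nonzero, and it has to
  move up to weight \<open>d + 1\<close>.
\<close>

lemma delsarte_feasible_parity_extend:
  assumes A: "delsarte_feasible m d A" and "odd d"
  shows "delsarte_feasible (Suc m) (Suc d) (parity_extend m A)"
  unfolding delsarte_feasible_def krawtchouk_transform_def[symmetric]
proof (intro conjI ballI)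
  fix j assume "j \<in> {1..Suc m}"
  then obtain l where "j = Suc l" "l \<le> m" by (cases j) auto
  then show "0 \<le> krawtchouk_transform (Suc m) (parity_extend m A) j"
    by (simp add: krawtchouk_transform_parity_extend krawtchouk_transform_nonneg[OF A])
next
  fix i assume i: "i \<in> {1..Suc d - 1}"
  show "parity_extend m A i = 0"
  proof (cases "even i")
    case True
    with i \<open>odd d\<close> have "i \<noteq> d" "i \<noteq> 1" by auto
    with i have "i \<in> {1..d - 1}" "i - 1 \<in> {1..d - 1}" by auto
    with A show ?thesis by (simp add: parity_extend_def delsarte_feasible_def)
  qed (simp add: parity_extend_def)
next
  show "parity_extend m A 0 = 1" using A by (simp add: parity_extend_def delsarte_feasible_def)
next
  fix i assume "i \<in> {1..Suc m}"
  then show "0 \<le> parity_extend m A i"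
    using delsarte_feasible_nonneg[OF A, of i] delsarte_feasible_nonneg[OF A, of "i - 1"]
    by (auto simp: parity_extend_def)
qed

section \<open>Matching optima\<close>

lemma delsarte_optimum_puncture:
  assumes A: "delsarte_optimum (Suc m) (Suc d) A" and "odd d"
  shows "delsarte_optimum m d (puncture m A)"
  unfolding delsarte_optimum_def
proof (intro conjI allI impI)
  have "d \<ge> 1" using \<open>odd d\<close> by (cases d) auto
  then show "delsarte_feasible m d (puncture m A)"
    using A by (intro delsarte_feasible_puncture) (auto simp: delsarte_optimum_def)
next
  fix B assume "delsarte_feasible m d B"
  then have "delsarte_feasible (Suc m) (Suc d) (parity_extend m B)"
    using \<open>odd d\<close> by (rule delsarte_feasible_parity_extend)
  with A have "delsarte_objective (Suc m) (parity_extend m B) \<le> delsarte_objective (Suc m) A"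
    by (simp add: delsarte_optimum_def)
  then show "delsarte_objective m B \<le> delsarte_objective m (puncture m A)"
    by (simp add: delsarte_objective_parity_extend delsarte_objective_puncture)
qed

theorem theorem4p2:
  fixes n e :: nat
  assumes "n > 0" and "e > 0" and "2 * e \<le> n"
  shows "\<exists>AE AO :: nat \<Rightarrow> real.
           delsarte_optimum n (2 * e) AE \<and>
           delsarte_optimum (n - 1) (2 * e - 1) AO \<and>
           (\<forall>j\<in>{0..n - 1}.
              krawtchouk_decomposition n AE j = krawtchouk_decomposition (n - 1) AO j)"
proof -
  obtain m where n: "n = Suc m" using \<open>n > 0\<close> by (cases n) auto
  obtain d where e: "2 * e = Suc d" using \<open>e > 0\<close> by (cases "2 * e") auto
  then have "odd d" by presburger
  obtain A where A: "delsarte_optimum (Suc m) (Suc d) A"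
    using delsarte_optimum_exists by blast
  have "delsarte_optimum m d (puncture m A)"
    using A \<open>odd d\<close> by (rule delsarte_optimum_puncture)
  with A show ?thesis
    unfolding n e
    by (intro exI[of _ A] exI[of _ "puncture m A"]) (auto simp: krawtchouk_decomposition_puncture)
qed

end
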